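(* Let $\mathcal{H}$ be a complex Hilbert space, let $\alpha,\beta$ be real numbers with $0\leq\alpha\leq 1\leq\beta$, let $T\in B(\mathcal{H})$ be an $(\alpha,\beta)$-normal operator, let $r\geq 0$ be a real number, and let $\lambda\in\mathbb{C}\setminus\{0\}$. If $\|\lambda T^{*}-T\|\leq r$, then $$\alpha\,\|T\|^{2}\leq w(T^{2})+\frac{r^{2}}{2|\lambda|}.$$
   Context: $B(\mathcal{H})$ denotes the algebra of bounded linear operators on the complex Hilbert space $(\mathcal{H};\langle\cdot,\cdot\rangle)$, and $\|\cdot\|$ denotes the operator norm. For real numbers $0\leq\alpha\leq 1\leq\beta$, an operator $T\in B(\mathcal{H})$ is called $(\alpha,\beta)$-normal if $\alpha^{2}T^{*}T\leq TT^{*}\leq\beta^{2}T^{*}T$ in the usual (Loewner) order of self-adjoint operators. The numerical radius of $T\in B(\mathcal{H})$ is $w(T)=\sup\{|\langle Tx,x\rangle| : x\in\mathcal{H},\ \|x\|=1\}$. *)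

theory Defs
  imports "HOL-Analysis.Analysis"
begin

section \<open>Complex Hilbert spaces\<close>

text \<open>
  The inner product is linear in the first and conjugate-linear in the second argument. The
  superclass supplies the norm, the topology and the underlying real vector space; the axioms
  force its norm to be the one induced by the inner product and its real scalar multiplication
  to be the restriction of the complex one.
\<close>

class complex_inner = real_normed_vector +
  fixes scaleC :: "complex \<Rightarrow> 'a \<Rightarrow> 'a"  (infixr \<open>*\<^sub>C\<close> 75)
    and cinner :: "'a \<Rightarrow> 'a \<Rightarrow> complex"
  assumes scaleC_add_right: "a *\<^sub>C (x + y) = a *\<^sub>C x + a *\<^sub>C y"
    and scaleC_add_left: "(a + b) *\<^sub>C x = a *\<^sub>C x + b *\<^sub>C x"
    and scaleC_scaleC: "a *\<^sub>C b *\<^sub>C x = (a * b) *\<^sub>C x"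
    and scaleC_one: "1 *\<^sub>C x = x"
    and scaleR_scaleC: "scaleR t x = complex_of_real t *\<^sub>C x"
    and cinner_commute: "cinner x y = cnj (cinner y x)"
    and cinner_add_left: "cinner (x + y) z = cinner x z + cinner y z"
    and cinner_scaleC_left: "cinner (a *\<^sub>C x) y = a * cinner x y"
    and cinner_ge_zero: "0 \<le> Re (cinner x x)"
    and cinner_eq_zero_iff: "cinner x x = 0 \<longleftrightarrow> x = 0"
    and norm_eq_sqrt_cinner: "norm x = sqrt (Re (cinner x x))"

class chilbert_space = complex_inner + complete_space

instantiation complex :: chilbert_space
begin

definition scaleC_complex :: "complex \<Rightarrow> complex \<Rightarrow> complex"
  where "scaleC_complex a x = a * x"

definition cinner_complex :: "complex \<Rightarrow> complex \<Rightarrow> complex"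
  where "cinner_complex x y = x * cnj y"

instance
  by standard
    (auto simp: scaleC_complex_def cinner_complex_def algebra_simps scaleR_conv_of_real
      cmod_def power2_eq_square)

end


section \<open>Bounded operators\<close>

text \<open>
  Elements of \<open>B(H)\<close> are functions satisfying \<open>bounded_clinear\<close>; the operator norm is the
  library's \<^const>\<open>onorm\<close>.
\<close>

definition bounded_clinear :: "('a::complex_inner \<Rightarrow> 'b::complex_inner) \<Rightarrow> bool"
  where "bounded_clinear T \<longleftrightarrow> bounded_linear T \<and> (\<forall>c x. T (c *\<^sub>C x) = c *\<^sub>C T x)"

definition cadjoint :: "('a::complex_inner \<Rightarrow> 'a) \<Rightarrow> 'a \<Rightarrow> 'a"
  where "cadjoint T = (THE S. \<forall>x y. cinner (T x) y = cinner x (S y))"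

definition positive_op :: "('a::complex_inner \<Rightarrow> 'a) \<Rightarrow> bool"
  where "positive_op A \<longleftrightarrow> (\<forall>x. cinner (A x) x \<in> \<real> \<and> 0 \<le> Re (cinner (A x) x))"

definition loewner_le :: "('a::complex_inner \<Rightarrow> 'a) \<Rightarrow> ('a \<Rightarrow> 'a) \<Rightarrow> bool"
  where "loewner_le A B \<longleftrightarrow> positive_op (\<lambda>x. B x - A x)"

definition alpha_beta_normal :: "real \<Rightarrow> real \<Rightarrow> ('a::complex_inner \<Rightarrow> 'a) \<Rightarrow> bool"
  where "alpha_beta_normal \<alpha> \<beta> T \<longleftrightarrow>
    loewner_le (\<lambda>x. \<alpha>\<^sup>2 *\<^sub>R cadjoint T (T x)) (\<lambda>x. T (cadjoint T x)) \<and>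
    loewner_le (\<lambda>x. T (cadjoint T x)) (\<lambda>x. \<beta>\<^sup>2 *\<^sub>R cadjoint T (T x))"

text \<open>
  The element 0 only matters on the zero space, which has no unit vectors: there it makes the
  numerical radius 0, while the supremum of the empty set of reals is unspecified. Otherwise it
  does not change the supremum, which ranges over nonnegative numbers.
\<close>

definition numerical_radius :: "('a::complex_inner \<Rightarrow> 'a) \<Rightarrow> real"
  where "numerical_radius T = Sup (insert 0 {cmod (cinner (T x) x) |x. norm x = 1})"


section \<open>The adjoint of a bounded operator exists\<close>

lemma cinner_add_right: "cinner x (y + z) = cinner x y + cinner x z"
  by (metis cinner_add_left cinner_commute complex_cnj_add)

lemma cinner_scaleC_right: "cinner x (a *\<^sub>C y) = cnj a * cinner x y"
  by (metis cinner_scaleC_left cinner_commute complex_cnj_mult)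

lemma cinner_minus_left: "cinner (- x) y = - cinner x y"
proof -
  have "- x = complex_of_real (- 1) *\<^sub>C x"
    by (metis scaleR_scaleC scaleR_minus1_left)
  then show ?thesis by (simp only: cinner_scaleC_left) simp
qed

lemma cinner_minus_right: "cinner x (- y) = - cinner x y"
  by (metis cinner_minus_left cinner_commute complex_cnj_minus)

lemma cinner_diff_left: "cinner (x - y) z = cinner x z - cinner y z"
  by (metis add_uminus_conv_diff cinner_add_left cinner_minus_left)

lemma cinner_diff_right: "cinner x (y - z) = cinner x y - cinner x z"
  by (metis cinner_diff_left cinner_commute complex_cnj_diff)

lemma cinner_self: "cinner x x = complex_of_real ((norm x)\<^sup>2)"
proof -
  have "Im (cinner x x) = 0"
    using arg_cong[OF cinner_commute[of x x], of Im] by simp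
  then show ?thesis
    by (simp add: complex_eq_iff norm_eq_sqrt_cinner cinner_ge_zero)
qed

lemma norm_add_square: "(norm (x + y))\<^sup>2 = (norm x)\<^sup>2 + (norm y)\<^sup>2 + 2 * Re (cinner x y)"
proof -
  have "(norm (x + y))\<^sup>2 = Re (cinner (x + y) (x + y))"
    by (simp only: cinner_self Re_complex_of_real)
  also have "\<dots> = Re (cinner x x) + Re (cinner y y) + Re (cinner x y) + Re (cinner y x)"
    by (simp add: cinner_add_left cinner_add_right)
  also have "Re (cinner y x) = Re (cinner x y)"
    using arg_cong[OF cinner_commute[of y x], of Re] by simp
  finally show ?thesis by (simp add: cinner_self)
qed

lemma cinner_scaleR_left: "cinner (t *\<^sub>R x) y = of_real t * cinner x y"
  by (simp add: scaleR_scaleC cinner_scaleC_left)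

lemma norm_scaleC: "norm (a *\<^sub>C x) = cmod a * norm (x :: 'a::complex_inner)"
proof -
  have "complex_of_real ((norm (a *\<^sub>C x))\<^sup>2) = complex_of_real ((cmod a * norm x)\<^sup>2)"
    unfolding cinner_self[symmetric] cinner_scaleC_left cinner_scaleC_right
    by (simp add: cinner_self power_mult_distrib complex_norm_square[of a, simplified] mult_ac)
  then have "(norm (a *\<^sub>C x))\<^sup>2 = (cmod a * norm x)\<^sup>2" by (simp only: of_real_eq_iff)
  then show ?thesis by (simp add: power2_eq_iff_nonneg)
qed

lemma Cauchy_Schwarz_Re: "Re (cinner x y) \<le> norm x * norm y"
proof -
  have "(norm (x + y))\<^sup>2 \<le> (norm x + norm y)\<^sup>2"
    by (intro power_mono norm_triangle_ineq norm_ge_zero)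
  then show ?thesis unfolding norm_add_square by (simp add: power2_sum)
qed

lemma Cauchy_Schwarz: "cmod (cinner x y) \<le> norm x * norm (y :: 'a::complex_inner)"
proof (cases "cinner x y = 0")
  case False
  define c where "c = cnj (cinner x y) / cmod (cinner x y)"
  have c: "cmod c = 1" using False by (simp add: c_def norm_divide)
  have "cinner (c *\<^sub>C x) y = cmod (cinner x y)"
    using False by (simp add: c_def cinner_scaleC_left complex_norm_square[symmetric]
        power2_eq_square mult.commute[of "cnj _"] field_simps)
  then show ?thesis using Cauchy_Schwarz_Re[of "c *\<^sub>C x" y] c by (simp add: norm_scaleC)
qed simp

lemma cinner_ext:
  assumes "\<And>x. cinner x y = cinner x z"
  shows "y = z"
proof -
  have "cinner (y - z) (y - z) = 0" using assms by (simp add: cinner_diff_right)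
  then show ?thesis by (simp add: cinner_eq_zero_iff)
qed

lemma Riesz_representation:
  fixes f :: "'a::chilbert_space \<Rightarrow> complex"
  assumes lin: "bounded_linear f" and sc: "\<And>c x. f (c *\<^sub>C x) = c * f x"
  shows "\<exists>z. \<forall>x. f x = cinner x z"
proof -
  interpret f: bounded_linear f by (fact lin)
  define J where "J = (\<lambda>x. (norm x)\<^sup>2 - 2 * Re (f x))"
  obtain K where K: "\<And>x. cmod (f x) \<le> norm x * K" using f.bounded by blast
  have lower: "- K\<^sup>2 \<le> J x" for x
  proof -
    have "Re (f x) \<le> norm x * K" using complex_Re_le_cmod[of "f x"] K[of x] by linarith
    moreover have "0 \<le> (norm x - K)\<^sup>2" by simp
    ultimately show ?thesis by (simp add: J_def power2_diff)
  qed
  define m where "m = Inf (range J)"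
  have bdd: "bdd_below (range J)" using lower by (meson bdd_belowI2)
  have m_le: "m \<le> J x" for x unfolding m_def by (intro cInf_lower bdd rangeI)
  have "\<exists>x. J x < m + inverse (real (Suc n))" for n
  proof -
    have "m < m + inverse (real (Suc n))" by simp
    then show ?thesis unfolding m_def by (subst (asm) cInf_less_iff) (use bdd in auto)
  qed
  then obtain X where X: "\<And>n. J (X n) < m + inverse (real (Suc n))" by metis
  have par: "(norm (x - y))\<^sup>2 = 2 * J x + 2 * J y - 4 * J ((1/2) *\<^sub>R (x + y))" for x y
  proof -
    have "(norm (x - y))\<^sup>2 = 2 * (norm x)\<^sup>2 + 2 * (norm y)\<^sup>2 - (norm (x + y))\<^sup>2"
      using norm_add_square[of x "- y"] norm_add_square[of x y]
      by (simp add: cinner_minus_right)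
    then show ?thesis
      by (simp add: J_def f.scaleR f.add power_divide add_divide_distrib)
  qed
  have dist_X: "(norm (X i - X j))\<^sup>2 < 4 * inverse (real (Suc n))" if "n \<le> i" "n \<le> j" for i j n
  proof -
    have "inverse (real (Suc i)) \<le> inverse (real (Suc n))"
      "inverse (real (Suc j)) \<le> inverse (real (Suc n))"
      using that by (auto intro!: le_imp_inverse_le)
    then show ?thesis
      using par[of "X i" "X j"] X[of i] X[of j] m_le[of "(1/2) *\<^sub>R (X i + X j)"] by linarith
  qed
  have "Cauchy X"
  proof (rule metric_CauchyI)
    fix e :: real assume "0 < e"
    then obtain n where n: "inverse (real (Suc n)) < e\<^sup>2 / 4"
      using reals_Archimedean[of "e\<^sup>2 / 4"] by auto
    have "dist (X i) (X j) < e" if "n \<le> i" "n \<le> j" for i j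
    proof -
      have "(norm (X i - X j))\<^sup>2 < e\<^sup>2" using dist_X[OF that] n by linarith
      then show ?thesis using \<open>0 < e\<close> by (simp add: dist_norm power2_less_imp_less)
    qed
    then show "\<exists>M. \<forall>i\<ge>M. \<forall>j\<ge>M. dist (X i) (X j) < e" by blast
  qed
  then obtain z where z: "X \<longlonglongrightarrow> z" using Cauchy_convergent convergent_def by blast
  have "(\<lambda>n. J (X n)) \<longlonglongrightarrow> J z"
    unfolding J_def by (intro tendsto_intros f.tendsto z)
  moreover have "(\<lambda>n. m + inverse (real (Suc n))) \<longlonglongrightarrow> m + 0"
    by (intro tendsto_add tendsto_const LIMSEQ_inverse_real_of_nat)
  ultimately have Jz: "J z \<le> m"
    using LIMSEQ_le[of "\<lambda>n. J (X n)" "J z" "\<lambda>n. m + inverse (real (Suc n))" m] X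
    by (auto intro: less_imp_le)
  have Re_eq: "Re (f x) = Re (cinner x z)" for x
  proof -
    define d where "d = Re (cinner x z) - Re (f x)"
    have ineq: "0 \<le> t\<^sup>2 * (norm x)\<^sup>2 + 2 * t * d" for t
    proof -
      have "J z \<le> J (t *\<^sub>R x + z)" using Jz m_le[of "t *\<^sub>R x + z"] by linarith
      then show ?thesis
        unfolding J_def norm_add_square
        by (simp add: f.add f.scaleR cinner_scaleR_left d_def power_mult_distrib algebra_simps)
    qed
    define N where "N = (norm x)\<^sup>2 + 1"
    have N: "N > 0" by (simp add: N_def add_nonneg_pos)
    have "0 \<le> (d / N)\<^sup>2 * (norm x)\<^sup>2 - 2 * (d\<^sup>2 / N)"
      using ineq[of "- d / N"] by (simp add: power2_eq_square)
    also have "\<dots> \<le> (d / N)\<^sup>2 * N - 2 * (d\<^sup>2 / N)"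
      unfolding N_def by (intro diff_right_mono mult_left_mono) auto
    also have "\<dots> = - (d\<^sup>2 / N)" using N by (simp add: power2_eq_square field_simps)
    finally have "d\<^sup>2 / N \<le> 0" by simp
    then have "d\<^sup>2 \<le> 0" using N by (simp add: divide_le_0_iff not_less)
    then show ?thesis by (simp add: d_def)
  qed
  have "f x = cinner x z" for x
  proof (rule complex_eqI)
    show "Im (f x) = Im (cinner x z)"
      using Re_eq[of "\<i> *\<^sub>C x"] by (simp add: sc cinner_scaleC_left)
  qed (rule Re_eq)
  then show ?thesis by blast
qed

lemma cadjoint:
  fixes T :: "'a::chilbert_space \<Rightarrow> 'a"
  assumes T: "bounded_clinear T"
  shows "cinner (T x) y = cinner x (cadjoint T y)"
proof -
  interpret T: bounded_linear T using T by (simp add: bounded_clinear_def)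
  have sc: "T (c *\<^sub>C x) = c *\<^sub>C T x" for c x using T by (simp add: bounded_clinear_def)
  obtain K where K: "\<And>x. norm (T x) \<le> norm x * K" using T.bounded by blast
  have "\<exists>z. \<forall>x. cinner (T x) y = cinner x z" for y
  proof (rule Riesz_representation)
    show "bounded_linear (\<lambda>x. cinner (T x) y)"
    proof (rule bounded_linear_intro)
      fix x
      have "cmod (cinner (T x) y) \<le> norm (T x) * norm y" by (rule Cauchy_Schwarz)
      also have "\<dots> \<le> (norm x * K) * norm y" by (intro mult_right_mono K) simp
      finally show "norm (cinner (T x) y) \<le> norm x * (K * norm y)" by (simp add: mult.assoc)
    qed (simp_all add: T.add T.scaleR cinner_add_left cinner_scaleR_left scaleR_conv_of_real)
    show "cinner (T (c *\<^sub>C x)) y = c * cinner (T x) y" for c x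
      by (simp add: sc cinner_scaleC_left)
  qed
  then obtain S where S: "\<forall>x y. cinner (T x) y = cinner x (S y)" by metis
  have "cadjoint T = S"
    unfolding cadjoint_def
  proof (rule the_equality)
    fix S' assume S': "\<forall>x y. cinner (T x) y = cinner x (S' y)"
    show "S' = S"
    proof
      fix y show "S' y = S y" by (rule cinner_ext) (use S S' in metis)
    qed
  qed (rule S)
  then show ?thesis using S by simp
qed

end

theory Submission
  imports Defs
begin

text \<open>
  Expanding \<open>\<parallel>\<lambda>T*x - Tx\<parallel>\<^sup>2 \<le> r\<^sup>2\<parallel>x\<parallel>\<^sup>2\<close>, the cross term is \<open>2 Re (\<lambda>\<langle>T*x, Tx\<rangle>)\<close>, and
  \<open>\<langle>T*x, Tx\<rangle>\<close> is the conjugate of \<open>\<langle>T\<^sup>2x, x\<rangle>\<close>, which the numerical radius of \<open>T\<^sup>2\<close> controls. The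
  square terms are at least \<open>2\<bar>\<lambda>\<bar> \<parallel>T*x\<parallel> \<parallel>Tx\<parallel>\<close> by AM-GM, and normality gives
  \<open>\<parallel>T*x\<parallel> \<ge> \<alpha> \<parallel>Tx\<parallel>\<close>.
\<close>

lemma cinner_cadjoint_left:
  fixes T :: "'a::chilbert_space \<Rightarrow> 'a"
  assumes "bounded_clinear T"
  shows "cinner (cadjoint T y) x = cinner y (T x)"
  by (metis assms cadjoint cinner_commute)

text \<open>Makes the hypothesis on \<open>onorm\<close> usable pointwise, since
  \<open>onorm\<close> bounds only bounded operators. The bound \<open>K\<close> of \<open>T\<close>
  carries over because \<open>\<parallel>T*x\<parallel>\<^sup>2 = Re \<langle>TT*x,
  x\<rangle>\<close>.\<close>

lemma bounded_linear_cadjoint: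
  fixes T :: "'a::chilbert_space \<Rightarrow> 'a"
  assumes T: "bounded_clinear T"
  shows "bounded_linear (cadjoint T)"
proof -
  interpret T: bounded_linear T using T by (simp add: bounded_clinear_def)
  obtain K where K: "\<And>x. norm (T x) \<le> norm x * K" using T.bounded by blast
  show ?thesis
  proof (rule bounded_linear_intro)
    show "cadjoint T (x + y) = cadjoint T x + cadjoint T y" for x y
      by (rule cinner_ext) (simp add: cadjoint[OF T, symmetric] cinner_add_right)
    show "cadjoint T (t *\<^sub>R x) = t *\<^sub>R cadjoint T x" for t x
      by (rule cinner_ext)
        (simp add: cadjoint[OF T, symmetric] cinner_scaleC_right scaleR_scaleC)
    show "norm (cadjoint T x) \<le> norm x * K" for x
    \<comment> \<open>The estimate below is divided by this norm. In the zero case nonnegativity of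
      \<open>norm x * K\<close> must come from the bound on \<open>T\<close>, as \<open>K\<close>
      has no assumed sign.\<close>
    proof (cases "norm (cadjoint T x) = 0")
      case True
      have "0 \<le> norm x * K" using K[of x] norm_ge_zero[of "T x"] by linarith
      then show ?thesis using True by simp
    next
      case False
      let ?y = "cadjoint T x"
      have "norm ?y * norm ?y = Re (cinner (T ?y) x)"
        by (simp add: cadjoint[OF T] cinner_self power2_eq_square)
      also have "\<dots> \<le> norm (T ?y) * norm x" by (rule Cauchy_Schwarz_Re)
      also have "\<dots> \<le> (norm ?y * K) * norm x" by (intro mult_right_mono K) simp
      finally have "norm ?y * norm ?y \<le> norm ?y * (norm x * K)" by (simp add: mult_ac)
      then show ?thesis using False by simp
    qed
  qed
qed

lemma bounded_linear_scaleC_right: "bounded_linear (\<lambda>x::'a::complex_inner. c *\<^sub>C x)"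
  by (rule bounded_linear_intro[where K = "cmod c"])
    (simp_all add: scaleC_add_right scaleR_scaleC scaleC_scaleC norm_scaleC mult.commute)

text \<open>A real \<open>Sup\<close> is an upper bound only for sets bounded above; Cauchy-Schwarz
  supplies the bound \<open>onorm S\<close>.\<close>

lemma bdd_above_numerical_radius:
  fixes S :: "'a::complex_inner \<Rightarrow> 'a"
  assumes "bounded_linear S"
  shows "bdd_above (insert 0 {cmod (cinner (S x) x) |x. norm x = 1})"
proof -
  have "cmod (cinner (S x) x) \<le> onorm S" if "norm x = 1" for x
    using Cauchy_Schwarz[of "S x" x] onorm[OF assms, of x] that by simp
  then have "bdd_above {cmod (cinner (S x) x) |x. norm x = 1}"
    by (auto intro: bdd_aboveI[of _ "onorm S"])
  then show ?thesis by simp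
qed

lemma numerical_radius_nonneg:
  assumes "bounded_linear S"
  shows "0 \<le> numerical_radius S"
  unfolding numerical_radius_def
  by (rule cSup_upper) (simp_all add: bdd_above_numerical_radius[OF assms] del: bdd_above_insert)

text \<open>Both sides are homogeneous of degree two in \<open>x\<close>, so normalising reduces the
  claim to unit vectors.\<close>

lemma cmod_cinner_le_numerical_radius:
  fixes S :: "'a::complex_inner \<Rightarrow> 'a"
  assumes S: "bounded_linear S"
  shows "cmod (cinner (S x) x) \<le> numerical_radius S * (norm x)\<^sup>2"
proof (cases "x = 0")
  case True
  then show ?thesis using Cauchy_Schwarz[of "S x" x] by simp
next
  case False
  define u where "u = x /\<^sub>R norm x"
  have u: "norm u = 1" and x: "x = norm x *\<^sub>R u" using False by (simp_all add: u_def)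
  have "cmod (cinner (S u) u) \<le> numerical_radius S"
    unfolding numerical_radius_def
    by (rule cSup_upper) (use u bdd_above_numerical_radius[OF S] in auto)
  moreover have "cinner (S x) x = of_real ((norm x)\<^sup>2) * cinner (S u) u"
  proof -
    \<comment> \<open>The equation \<open>x\<close> has \<open>x\<close> on both sides and would
      loop as a simp rule, so it is used by single substitution and by congruence.\<close>
    have "S x = norm x *\<^sub>R S u"
      by (subst x) (rule linear_scale[OF bounded_linear.linear[OF S]])
    then have "cinner (S x) x = cinner (norm x *\<^sub>R S u) (norm x *\<^sub>R u)"
      using x by (rule arg_cong2[of _ _ _ _ cinner])
    then show ?thesis
      by (simp add: cinner_scaleC_left cinner_scaleC_right scaleR_scaleC power2_eq_square)
  qed
  ultimately show ?thesis
    by (simp add: norm_mult norm_power mult.commute[of "numerical_radius S"] mult_left_mono)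
qed

text \<open>Evaluates the lower Loewner inequality at \<open>x\<close>, where \<open>\<langle>TT*x,
  x\<rangle> = \<parallel>T*x\<parallel>\<^sup>2\<close> and
  \<open>\<langle>T*Tx, x\<rangle> = \<parallel>Tx\<parallel>\<^sup>2\<close>.\<close>

lemma alpha_beta_normal_norm_cadjoint_ge:
  fixes T :: "'a::chilbert_space \<Rightarrow> 'a"
  assumes T: "bounded_clinear T" and n: "alpha_beta_normal \<alpha> \<beta> T"
  shows "\<alpha> * norm (T x) \<le> norm (cadjoint T x)"
proof -
  have "0 \<le> Re (cinner (T (cadjoint T x) - \<alpha>\<^sup>2 *\<^sub>R cadjoint T (T x)) x)"
    using n by (simp add: alpha_beta_normal_def loewner_le_def positive_op_def)
  also have "\<dots> = (norm (cadjoint T x))\<^sup>2 - (\<alpha> * norm (T x))\<^sup>2"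
    unfolding cinner_diff_left cinner_scaleR_left cadjoint[OF T, of "cadjoint T x"]
      cinner_cadjoint_left[OF T, of "T x"] cinner_self
    by (simp add: power_mult_distrib)
  finally have "(\<alpha> * norm (T x))\<^sup>2 \<le> (norm (cadjoint T x))\<^sup>2" by simp
  then show ?thesis by (rule power2_le_imp_le) simp
qed

theorem theorem2p6:
  fixes T :: "'a::chilbert_space \<Rightarrow> 'a"
    and \<alpha> \<beta> r :: real
    and l :: complex
  assumes "0 \<le> \<alpha>" and "\<alpha> \<le> 1" and "1 \<le> \<beta>"
    and "bounded_clinear T"
    and "alpha_beta_normal \<alpha> \<beta> T"
    and "0 \<le> r"
    and "l \<noteq> 0"
    and "onorm (\<lambda>x. l *\<^sub>C cadjoint T x - T x) \<le> r"
  shows "\<alpha> * (onorm T)\<^sup>2 \<le> numerical_radius (T \<circ> T) + r\<^sup>2 / (2 * cmod l)"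
proof -
  note T = \<open>bounded_clinear T\<close>
  have bT: "bounded_linear T" using T by (simp add: bounded_clinear_def)
  have bTT: "bounded_linear (T \<circ> T)"
    using bounded_linear_compose[OF bT bT] by (simp add: comp_def)
  have bD: "bounded_linear (\<lambda>x. l *\<^sub>C cadjoint T x - T x)"
    by (intro bounded_linear_sub bT
        bounded_linear_compose[OF bounded_linear_scaleC_right bounded_linear_cadjoint[OF T]])
  define w where "w = numerical_radius (T \<circ> T)"
  define C where "C = w + r\<^sup>2 / (2 * cmod l)"
  have l: "cmod l > 0" using \<open>l \<noteq> 0\<close> by simp
  have C: "0 \<le> C" using numerical_radius_nonneg[OF bTT] by (simp add: C_def w_def)
  have pointwise: "\<alpha> * (norm (T x))\<^sup>2 \<le> C * (norm x)\<^sup>2" for x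
  proof -
    let ?S = "cadjoint T x"
    have "norm (l *\<^sub>C ?S - T x) \<le> r * norm x"
      using onorm[OF bD, of x] assms(8) by (meson mult_right_mono norm_ge_zero order_trans)
    then have "(norm (l *\<^sub>C ?S - T x))\<^sup>2 \<le> (r * norm x)\<^sup>2" by (intro power_mono) simp_all
    moreover have "(norm (l *\<^sub>C ?S - T x))\<^sup>2
        = (cmod l * norm ?S)\<^sup>2 + (norm (T x))\<^sup>2 - 2 * Re (l * cinner ?S (T x))"
      using norm_add_square[of "l *\<^sub>C ?S" "- T x"]
      by (simp add: cinner_minus_right cinner_scaleC_left norm_scaleC)
    moreover have "Re (l * cinner ?S (T x)) \<le> cmod l * (w * (norm x)\<^sup>2)"
    proof -
      have "cmod (cinner ?S (T x)) = cmod (cinner ((T \<circ> T) x) x)"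
        unfolding comp_apply cadjoint[OF T, of "T x"] cinner_commute[of "cadjoint T x" "T x"]
        by (rule complex_mod_cnj)
      then have "cmod (l * cinner ?S (T x)) \<le> cmod l * (w * (norm x)\<^sup>2)"
        using cmod_cinner_le_numerical_radius[OF bTT, of x]
        by (simp add: norm_mult w_def mult_left_mono)
      then show ?thesis using complex_Re_le_cmod order_trans by blast
    qed
    moreover have "2 * (cmod l * (\<alpha> * (norm (T x))\<^sup>2)) \<le> (cmod l * norm ?S)\<^sup>2 + (norm (T x))\<^sup>2"
    proof -
      have "\<alpha> * norm (T x) * norm (T x) \<le> norm ?S * norm (T x)"
        by (intro mult_right_mono alpha_beta_normal_norm_cadjoint_ge[OF T assms(5)]) simp
      then have "cmod l * (\<alpha> * (norm (T x))\<^sup>2) \<le> cmod l * (norm ?S * norm (T x))"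
        by (intro mult_left_mono) (simp_all add: power2_eq_square mult.assoc)
      then show ?thesis
        using sum_squares_bound[of "cmod l * norm ?S" "norm (T x)"] by (simp add: mult.assoc)
    qed
    ultimately have "2 * cmod l * (\<alpha> * (norm (T x))\<^sup>2)
        \<le> 2 * cmod l * (w * (norm x)\<^sup>2) + (r * norm x)\<^sup>2"
      by linarith
    \<comment> \<open>Factoring out \<open>2 * cmod l\<close> turns \<open>r\<^sup>2\<close> into
      the summand \<open>r\<^sup>2 / (2 * cmod l)\<close> of \<open>C\<close>.\<close>
    also have "\<dots> = 2 * cmod l * (C * (norm x)\<^sup>2)"
      using l by (simp add: C_def field_simps)
    finally show ?thesis using l by simp
  qed
  have "\<alpha> * (onorm T)\<^sup>2 \<le> C"
  \<comment> \<open>For positive \<open>\<alpha>\<close> the pointwise bound makes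
    \<open>sqrt (C / \<alpha>)\<close> a bound for \<open>onorm T\<close>; for
    \<open>\<alpha> = 0\<close> the claim is just \<open>0 \<le> C\<close>.\<close>
  proof (cases "\<alpha> = 0")
    case False
    with \<open>0 \<le> \<alpha>\<close> have \<alpha>: "\<alpha> > 0" by simp
    have "norm (T x) \<le> sqrt (C / \<alpha>) * norm x" for x
    proof (rule power2_le_imp_le)
      show "(norm (T x))\<^sup>2 \<le> (sqrt (C / \<alpha>) * norm x)\<^sup>2"
        using pointwise[of x] \<alpha> C by (simp add: field_simps)
    qed (use \<alpha> C in simp)
    then have "onorm T \<le> sqrt (C / \<alpha>)" using \<alpha> C by (intro onorm_bound) simp_all
    then have "(onorm T)\<^sup>2 \<le> (sqrt (C / \<alpha>))\<^sup>2" by (intro power_mono onorm_pos_le bT)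
    then show ?thesis using \<alpha> C by (simp add: field_simps)
  qed (simp add: C)
  then show ?thesis by (simp add: C_def w_def)
qed

end
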